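(* Consider the generalized semi-infinite program (GSIP): minimize $f(x)$ over $x\in X$ subject to $g(x,u)\ge0$ for all $u\in U(x)$. Run the algorithm described in the context and assume that the inner loop terminates after finitely many iterations for every $J\in\mathcal{P}$. Then $f^*=\min\{\bar f,\ f_J^*\ (J\in\mathcal{P})\}$ is the global optimal value of the GSIP, and the corresponding output $x^*$ is a global optimizer of the GSIP.
   Context: Setting: $x\in\mathbb{R}^n$, $u\in\mathbb{R}^p$; $X\subseteq\mathbb{R}^n$ is semialgebraic; $f(x)$, $g(x,u)$ are real polynomials; $A=[a_1\ \cdots\ a_m]^T\in\mathbb{R}^{m\times p}$ is constant, $b(x)=(b_1(x),\dots,b_m(x))^T$ is a vector of polynomials; $U(x)=\{u\in\mathbb{R}^p: Au\ge b(x)\}$ is locally bounded on $X$ (every $\hat x\in X$ has a neighborhood $C_1$ and a bounded set $C_2$ with $U(x)\subseteq C_2$ for all $x\in C_1$). The value function is $v(x)=\inf\{g(x,u):u\in U(x)\}$ ($=+\infty$ if $U(x)=\emptyset$), and $S(x)=\{u\in U(x): g(x,u)=v(x)\}$. Let $r=\operatorname{rank}(A)$; for $J=\{j_1,\dots,j_r\}\subseteq[m]=\{1,\dots,m\}$ let $A_J=[a_{j_1}\ \cdots\ a_{j_r}]^T$, $b_J=(b_{j_1},\dots,b_{j_r})^T$; $\mathcal{P}=\{J\subseteq[m]:\operatorname{rank}(A_J)=|J|=r\}$. For $J\in\mathcal{P}$, $$\mathcal{K}_J(x)=\{u\in U(x):\exists\lambda_J\in\mathbb{R}^r,\ \nabla_ug(x,u)-A_J^T\lambda_J=0,\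 0\le A_Ju-b_J(x)\perp\lambda_J\ge0\},$$ where $0\le y\perp w\ge0$ means $y\ge0,w\ge0,y^Tw=0$. Algorithm. Step 1: solve: minimize $f(x)$ over $(x,y)$ subject to $A^Ty=0$, $b(x)^Ty=1$, $y\ge0$, $x\in X$, $y\in\mathbb{R}^m$, for its optimal value $\bar f$ and an optimizer $(\bar x,\bar y)$ ($\bar f=+\infty$ if infeasible). If infeasible, choose a finite (possibly empty) set $\Phi_0$ of polynomial maps $\phi:\mathbb{R}^n\to\mathbb{R}^p$ with $\phi(x)\in U(x)$ for all $x\in X$; otherwise $\Phi_0=\emptyset$. Step 2: for every $J\in\mathcal{P}$, set $k=0$ and run the inner loop: (2.1) solve $(P_{J,k})$: $f_{J,k}=\min f(x)$ over $(x,u)$ subject to $x\in X$, $u\in\mathcal{K}_J(x)$, $g(x,u)\ge0$, $g(x,\phi(x))\ge0$ for all $\phi\in\Phi_k$; if infeasible, terminate the inner loop for this $J$ (with $f_J^*=+\infty$); otherwise take a global minimizer $(x_J^k,u_J^k)$. (2.2) If $v(x_J^k)\ge0$, set $f_J^*=f_{J,k}$, $x_J^*=x_J^k$, $u_J^*=u_J^k$ and terminate the inner loop for this $J$. If $v(x_J^k)<0$, take $\hat u_J^k\in S(x_J^k)$. (2.3) Take a polynomial map $q^{(k)}:\mathbb{R}^n\to\mathbb{R}^p$ with $q^{(k)}(x_J^k)=\hat u_J^k$ and $q^{(k)}(x)\in U(x)$ for all $x\in X$ with $U(x)\ne\emptyset$; set $\Phi_{k+1}=\Phi_k\cup\{q^{(k)}\}$,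 increase $k$ by one, and return to (2.1). Step 3: set $f^*=\min\{\bar f, f_J^*\ (J\in\mathcal{P})\}$; if $f^*=\bar f$ set $x^*=\bar x$, otherwise set $x^*=x_J^*$ for a $J\in\mathcal{P}$ with $f^*=f_J^*$. Output $f^*$ and $x^*$. All optimization problems that are feasible are assumed to be solved to global optimality with attained optimizers, as the algorithm requires; the output $x^*$ exists when at least one of the problems yields a finite value. *)

theory Defs
  imports "HOL-Analysis.Analysis" "HOL-Library.Extended_Real"
begin

section \<open>Semialgebraic sets and gradients\<close>

definition basic_semialgebraic :: "('a::euclidean_space) set \<Rightarrow> bool" where
  "basic_semialgebraic S \<longleftrightarrow>
     (\<exists>E G. finite E \<and> finite G \<and>
        (\<forall>p\<in>E. real_polynomial_function p) \<and> (\<forall>p\<in>G. real_polynomial_function p) \<and>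
        S = {x. (\<forall>p\<in>E. p x = 0) \<and> (\<forall>p\<in>G. p x > 0)})"

definition semialgebraic :: "('a::euclidean_space) set \<Rightarrow> bool" where
  "semialgebraic S \<longleftrightarrow> (\<exists>C. finite C \<and> (\<forall>B\<in>C. basic_semialgebraic B) \<and> S = \<Union>C)"

definition gradient :: "(real^'p \<Rightarrow> real) \<Rightarrow> real^'p \<Rightarrow> real^'p" where
  "gradient h u = (\<chi> i. frechet_derivative h (at u) (axis i 1))"

section \<open>Optimal values\<close>

text \<open>As an extended real, so that an infeasible problem has optimal value \<open>\<infinity>\<close>.
  Optimal solutions are expressed with \<^const>\<open>is_arg_min\<close>.\<close>

definition opt_value :: "('a \<Rightarrow> real) \<Rightarrow> 'a set \<Rightarrow> ereal" where
  "opt_value h F = (INF z\<in>F. ereal (h z))"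

section \<open>The generalized semi-infinite program\<close>

text \<open>The rows \<open>a\<^sub>1, \<dots>, a\<^sub>m\<close> of \<open>A\<close> are indexed by the finite type \<open>'m\<close>;
  the order on vectors is the componentwise one.\<close>

definition U_set :: "real^'p^'m \<Rightarrow> (real^'n \<Rightarrow> real^'m) \<Rightarrow> real^'n \<Rightarrow> (real^'p) set" where
  "U_set A b x = {u. A *v u \<ge> b x}"

definition locally_bounded_on :: "(real^'n) set \<Rightarrow> (real^'n \<Rightarrow> (real^'p) set) \<Rightarrow> bool" where
  "locally_bounded_on X V \<longleftrightarrow>
     (\<forall>z\<in>X. \<exists>C1 C2. z \<in> interior C1 \<and> bounded C2 \<and> (\<forall>x\<in>C1. V x \<subseteq> C2))"

definition value_fun ::
  "(real^'n \<Rightarrow> real^'p \<Rightarrow> real) \<Rightarrow> real^'p^'m \<Rightarrow> (real^'n \<Rightarrow> real^'m) \<Rightarrow> real^'n \<Rightarrow> ereal" where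
  "value_fun g A b x = opt_value (g x) (U_set A b x)"

definition S_set ::
  "(real^'n \<Rightarrow> real^'p \<Rightarrow> real) \<Rightarrow> real^'p^'m \<Rightarrow> (real^'n \<Rightarrow> real^'m) \<Rightarrow> real^'n \<Rightarrow> (real^'p) set" where
  "S_set g A b x = {u \<in> U_set A b x. ereal (g x u) = value_fun g A b x}"

definition gsip_feasible ::
  "(real^'n) set \<Rightarrow> (real^'n \<Rightarrow> real^'p \<Rightarrow> real) \<Rightarrow> real^'p^'m \<Rightarrow> (real^'n \<Rightarrow> real^'m)
    \<Rightarrow> (real^'n) set" where
  "gsip_feasible X g A b = {x \<in> X. \<forall>u\<in>U_set A b x. g x u \<ge> 0}"

section \<open>Partial Lagrange multipliers\<close>

text \<open>\<open>A\<^sub>J\<close> consists of the rows of \<open>A\<close> with index in \<open>J\<close>; its rank is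
  the dimension spanned by these rows.\<close>

definition index_sets :: "real^'p^'m \<Rightarrow> 'm set set" where
  "index_sets A = {J. dim ((\<lambda>j. row j A) ` J) = card J \<and> card J = rank A}"

text \<open>A multiplier \<open>\<lambda>\<^sub>J\<close> is a function on all indices of which only the values on \<open>J\<close>
  are used, so that \<open>A\<^sub>J\<^sup>T \<lambda>\<^sub>J\<close> is the sum below and \<open>row j A \<bullet> u - b x $ j\<close>, for \<open>j \<in> J\<close>,
  are the entries of \<open>A\<^sub>J u - b\<^sub>J(x)\<close>.\<close>

definition K_set ::
  "(real^'n \<Rightarrow> real^'p \<Rightarrow> real) \<Rightarrow> real^'p^'m \<Rightarrow> (real^'n \<Rightarrow> real^'m) \<Rightarrow> 'm set
    \<Rightarrow> real^'n \<Rightarrow> (real^'p) set" where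
  "K_set g A b J x = {u \<in> U_set A b x. \<exists>l :: 'm \<Rightarrow> real.
      gradient (g x) u - (\<Sum>j\<in>J. l j *\<^sub>R row j A) = 0 \<and>
      (\<forall>j\<in>J. 0 \<le> row j A \<bullet> u - b x $ j) \<and>
      (\<forall>j\<in>J. 0 \<le> l j) \<and>
      (\<Sum>j\<in>J. (row j A \<bullet> u - b x $ j) * l j) = 0}"

section \<open>The algorithm\<close>

definition step1_feasible ::
  "(real^'n) set \<Rightarrow> real^'p^'m \<Rightarrow> (real^'n \<Rightarrow> real^'m) \<Rightarrow> ((real^'n) \<times> (real^'m)) set" where
  "step1_feasible X A b = {(x, y). transpose A *v y = 0 \<and> b x \<bullet> y = 1 \<and> y \<ge> 0 \<and> x \<in> X}"

definition step1 ::
  "(real^'n) set \<Rightarrow> (real^'n \<Rightarrow> real) \<Rightarrow> real^'p^'m \<Rightarrow> (real^'n \<Rightarrow> real^'m)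
    \<Rightarrow> ereal \<Rightarrow> real^'n \<Rightarrow> real^'m \<Rightarrow> (real^'n \<Rightarrow> real^'p) set \<Rightarrow> bool" where
  "step1 X f A b fbar xbar ybar \<Phi>0 \<longleftrightarrow>
     fbar = opt_value (\<lambda>(x, y). f x) (step1_feasible X A b) \<and>
     (if step1_feasible X A b = {}
      then finite \<Phi>0 \<and> (\<forall>\<phi>\<in>\<Phi>0. polynomial_function \<phi> \<and> (\<forall>x\<in>X. \<phi> x \<in> U_set A b x))
      else is_arg_min (\<lambda>(x, y). f x) (\<lambda>z. z \<in> step1_feasible X A b) (xbar, ybar) \<and> \<Phi>0 = {})"

text \<open>Feasible set of the subproblem for \<open>J\<close> with the current set \<open>\<Phi>\<close> of polynomial maps.\<close>

definition sub_feasible ::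
  "(real^'n) set \<Rightarrow> (real^'n \<Rightarrow> real^'p \<Rightarrow> real) \<Rightarrow> real^'p^'m \<Rightarrow> (real^'n \<Rightarrow> real^'m)
    \<Rightarrow> 'm set \<Rightarrow> (real^'n \<Rightarrow> real^'p) set \<Rightarrow> ((real^'n) \<times> (real^'p)) set" where
  "sub_feasible X g A b J \<Phi> =
     {(x, u). x \<in> X \<and> u \<in> K_set g A b J x \<and> g x u \<ge> 0 \<and> (\<forall>\<phi>\<in>\<Phi>. g x (\<phi> x) \<ge> 0)}"

text \<open>One inner loop is described by the sequences of its sets \<open>\<Phi>\<close>, minimizers \<open>(xs, us)\<close>,
  points \<open>uh\<close> and polynomial maps \<open>q\<close>. The values of these sequences beyond a
  terminating iteration are irrelevant and left unconstrained.\<close>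

definition stops_at ::
  "(real^'n) set \<Rightarrow> (real^'n \<Rightarrow> real^'p \<Rightarrow> real) \<Rightarrow> real^'p^'m \<Rightarrow> (real^'n \<Rightarrow> real^'m)
    \<Rightarrow> 'm set \<Rightarrow> (nat \<Rightarrow> (real^'n \<Rightarrow> real^'p) set) \<Rightarrow> (nat \<Rightarrow> real^'n) \<Rightarrow> nat \<Rightarrow> bool" where
  "stops_at X g A b J \<Phi> xs k \<longleftrightarrow>
     sub_feasible X g A b J (\<Phi> k) = {} \<or> value_fun g A b (xs k) \<ge> 0"

definition inner_loop ::
  "(real^'n) set \<Rightarrow> (real^'n \<Rightarrow> real) \<Rightarrow> (real^'n \<Rightarrow> real^'p \<Rightarrow> real) \<Rightarrow> real^'p^'m
    \<Rightarrow> (real^'n \<Rightarrow> real^'m) \<Rightarrow> (real^'n \<Rightarrow> real^'p) set \<Rightarrow> 'm set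
    \<Rightarrow> (nat \<Rightarrow> (real^'n \<Rightarrow> real^'p) set) \<Rightarrow> (nat \<Rightarrow> real^'n) \<Rightarrow> (nat \<Rightarrow> real^'p)
    \<Rightarrow> (nat \<Rightarrow> real^'p) \<Rightarrow> (nat \<Rightarrow> real^'n \<Rightarrow> real^'p) \<Rightarrow> bool" where
  "inner_loop X f g A b \<Phi>0 J \<Phi> xs us uh q \<longleftrightarrow>
     \<Phi> 0 = \<Phi>0 \<and>
     (\<forall>k. (\<forall>i<k. \<not> stops_at X g A b J \<Phi> xs i) \<longrightarrow>
        (sub_feasible X g A b J (\<Phi> k) \<noteq> {} \<longrightarrow>
           is_arg_min (\<lambda>(x, u). f x) (\<lambda>z. z \<in> sub_feasible X g A b J (\<Phi> k)) (xs k, us k)) \<and>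
        (\<not> stops_at X g A b J \<Phi> xs k \<longrightarrow>
           uh k \<in> S_set g A b (xs k) \<and>
           polynomial_function (q k) \<and> q k (xs k) = uh k \<and>
           (\<forall>x\<in>X. U_set A b x \<noteq> {} \<longrightarrow> q k x \<in> U_set A b x) \<and>
           \<Phi> (Suc k) = \<Phi> k \<union> {q k}))"

definition inner_loop_terminates ::
  "(real^'n) set \<Rightarrow> (real^'n \<Rightarrow> real^'p \<Rightarrow> real) \<Rightarrow> real^'p^'m \<Rightarrow> (real^'n \<Rightarrow> real^'m)
    \<Rightarrow> 'm set \<Rightarrow> (nat \<Rightarrow> (real^'n \<Rightarrow> real^'p) set) \<Rightarrow> (nat \<Rightarrow> real^'n) \<Rightarrow> bool" where
  "inner_loop_terminates X g A b J \<Phi> xs \<longleftrightarrow> (\<exists>k. stops_at X g A b J \<Phi> xs k)"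

definition inner_loop_result ::
  "(real^'n) set \<Rightarrow> (real^'n \<Rightarrow> real) \<Rightarrow> (real^'n \<Rightarrow> real^'p \<Rightarrow> real) \<Rightarrow> real^'p^'m
    \<Rightarrow> (real^'n \<Rightarrow> real^'m) \<Rightarrow> 'm set
    \<Rightarrow> (nat \<Rightarrow> (real^'n \<Rightarrow> real^'p) set) \<Rightarrow> (nat \<Rightarrow> real^'n) \<Rightarrow> (nat \<Rightarrow> real^'p)
    \<Rightarrow> ereal \<Rightarrow> real^'n \<Rightarrow> real^'p \<Rightarrow> bool" where
  "inner_loop_result X f g A b J \<Phi> xs us fJ xJ uJ \<longleftrightarrow>
     (\<forall>k. stops_at X g A b J \<Phi> xs k \<and> (\<forall>i<k. \<not> stops_at X g A b J \<Phi> xs i) \<longrightarrow>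
        (if sub_feasible X g A b J (\<Phi> k) = {} then fJ = \<infinity>
         else fJ = opt_value (\<lambda>(x, u). f x) (sub_feasible X g A b J (\<Phi> k)) \<and>
              xJ = xs k \<and> uJ = us k))"

text \<open>If \<open>fstar = \<infinity>\<close>, no subproblem has produced a point and \<open>xstar\<close> is meaningless.\<close>

definition step3 ::
  "real^'p^'m \<Rightarrow> ereal \<Rightarrow> real^'n \<Rightarrow> ('m set \<Rightarrow> ereal) \<Rightarrow> ('m set \<Rightarrow> real^'n)
    \<Rightarrow> ereal \<Rightarrow> real^'n \<Rightarrow> bool" where
  "step3 A fbar xbar fJ xJ fstar xstar \<longleftrightarrow>
     fstar = Min ({fbar} \<union> fJ ` index_sets A) \<and>
     (if fstar = fbar then xstar = xbar
      else (\<exists>J\<in>index_sets A. fstar = fJ J \<and> xstar = xJ J))"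

end

theory Submission imports Defs begin

text \<open>
  A GSIP-feasible point \<open>x\<close> has either \<open>U(x) = \<emptyset>\<close> or \<open>U(x) \<noteq> \<emptyset>\<close>.
  By Farkas' lemma the former are exactly the points covered by Step 1. For the latter,
  \<open>U(x)\<close> is a nonempty compact polyhedron, so \<open>g(x, \<cdot>)\<close> has a minimizer \<open>u\<close> on it, whose
  gradient lies in the cone of the active rows of \<open>A\<close>. By the conic form of Caratheodory's
  theorem, the multiplier can be supported on linearly independent rows, which extend to a basis of
  the row space. Hence \<open>u \<in> K\<^sub>J(x)\<close> for some \<open>J\<close>, and \<open>(x, u)\<close> is feasible
  for every subproblem of the loop for \<open>J\<close>, because all the maps in \<open>\<Phi>\<^sub>k\<close> are
  selections of \<open>U\<close>. So the output is a lower bound of the GSIP, and every finite candidate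
  value is attained at a GSIP-feasible point by the termination criterion.
\<close>

section \<open>Finitely generated cones\<close>

text \<open>The nonnegative combinations form a convex cone containing the generators, so hull
  minimality applies. Weights sit on indices, not on vectors: in \<open>U_set_empty_iff\<close> they
  become the entries of a vector \<open>y\<close> even when generators coincide.\<close>

lemma convex_cone_hull_image_sum:
  fixes a :: "'i \<Rightarrow> 'a::real_vector"
  assumes "finite I" "x \<in> convex_cone hull (a ` I)"
  obtains w where "\<And>i. i \<in> I \<Longrightarrow> 0 \<le> w i" "x = (\<Sum>i\<in>I. w i *\<^sub>R a i)"
proof -
  let ?C = "{x. \<exists>w. (\<forall>i\<in>I. (0::real) \<le> w i) \<and> x = (\<Sum>i\<in>I. w i *\<^sub>R a i)}"
  have "convex_cone hull (a ` I) \<subseteq> ?C"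
  proof (rule hull_minimal)
    show "a ` I \<subseteq> ?C"
    proof (clarify, intro exI conjI)
      fix k assume "k \<in> I"
      then show "a k = (\<Sum>i\<in>I. (if i = k then 1 else 0) *\<^sub>R a i)"
        using \<open>finite I\<close> by (simp add: if_distrib[of "\<lambda>c. c *\<^sub>R _"] cong: if_cong)
    qed simp
    show "convex_cone ?C"
      unfolding convex_cone_iff
    proof (intro conjI allI ballI impI)
      show "0 \<in> ?C"
        by (intro CollectI exI[of _ "\<lambda>i. 0"]) auto
    next
      fix x y assume "x \<in> ?C" "y \<in> ?C"
      then obtain w w' where "\<forall>i\<in>I. 0 \<le> w i" "x = (\<Sum>i\<in>I. w i *\<^sub>R a i)"
        "\<forall>i\<in>I. 0 \<le> w' i" "y = (\<Sum>i\<in>I. w' i *\<^sub>R a i)"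
        by blast
      then show "x + y \<in> ?C"
        by (intro CollectI exI[of _ "\<lambda>i. w i + w' i"]) (auto simp: scaleR_add_left sum.distrib)
    next
      fix x and c :: real assume "x \<in> ?C" "0 \<le> c"
      then obtain w where "\<forall>i\<in>I. 0 \<le> w i" "x = (\<Sum>i\<in>I. w i *\<^sub>R a i)"
        by blast
      with \<open>0 \<le> c\<close> show "c *\<^sub>R x \<in> ?C"
        by (intro CollectI exI[of _ "\<lambda>i. c * w i"]) (auto simp: scaleR_sum_right)
    qed
  qed
  then show thesis
    using assms that by blast
qed

text \<open>Conic Caratheodory: as long as \<open>S\<close> is dependent, a multiple of a linear
  relation is subtracted from the weights until one of them vanishes, and that vector is
  dropped.\<close>

lemma nonneg_combination_independent_subset:
  fixes S :: "'a::real_vector set"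
  assumes "finite S" "\<And>v. v \<in> S \<Longrightarrow> 0 \<le> w v"
  shows "\<exists>T w'. T \<subseteq> S \<and> independent T \<and> (\<forall>v\<in>T. 0 \<le> w' v) \<and>
    (\<Sum>v\<in>S. w v *\<^sub>R v) = (\<Sum>v\<in>T. w' v *\<^sub>R v)"
  using assms
proof (induction "card S" arbitrary: S w rule: less_induct)
  case less
  show ?case
  proof (cases "independent S")
    case True
    with less.prems show ?thesis by blast
  next
    case False
    then obtain u0 v0 where u0: "v0 \<in> S" "u0 v0 \<noteq> 0" "(\<Sum>v\<in>S. u0 v *\<^sub>R v) = 0"
      using \<open>finite S\<close> by (auto simp: dependent_finite)
    \<comment> \<open>The sign normalises the relation to have a positive coefficient, so that
      \<open>P\<close> below is nonempty.\<close>
    define u where "u = (\<lambda>v. sgn (u0 v0) * u0 v)"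
    have u: "u v0 > 0" "(\<Sum>v\<in>S. u v *\<^sub>R v) = 0"
      using u0 by (auto simp: u_def sgn_if simp flip: scaleR_scaleR scaleR_sum_right)
    define P where "P = {v\<in>S. u v > 0}"
    have P: "finite P" "P \<noteq> {}"
      using \<open>finite S\<close> u0 u by (auto simp: P_def)
    \<comment> \<open>Ratio test: \<open>t\<close> is the largest multiple of \<open>u\<close> that
      can be subtracted with all weights staying nonnegative; a minimizing \<open>s\<close> gets
      weight zero.\<close>
    define t where "t = Min ((\<lambda>v. w v / u v) ` P)"
    have "t \<in> (\<lambda>v. w v / u v) ` P"
      unfolding t_def using P by (intro Min_in) auto
    then obtain s where s: "s \<in> P" "t = w s / u s"
      by blast
    have t_le: "t \<le> w v / u v" if "v \<in> P" for v
      unfolding t_def using P that by auto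
    have "0 \<le> t"
      using s less.prems(2) by (auto simp: P_def)
    have nonneg: "0 \<le> w v - t * u v" if "v \<in> S" for v
    proof (cases "u v > 0")
      case True
      then show ?thesis
        using t_le[of v] that by (simp add: P_def field_simps)
    next
      case False
      then have "t * u v \<le> 0"
        using \<open>0 \<le> t\<close> by (simp add: mult_nonneg_nonpos)
      then show ?thesis
        using less.prems(2)[OF that] by linarith
    qed
    have "s \<in> S" "w s - t * u s = 0"
      using s by (auto simp: P_def)
    have "(\<Sum>v\<in>S. w v *\<^sub>R v) = (\<Sum>v\<in>S. (w v - t * u v) *\<^sub>R v)"
      using u(2) by (simp add: scaleR_diff_left sum_subtractf flip: scaleR_scaleR scaleR_sum_right)
    also have "\<dots> = (\<Sum>v\<in>S - {s}. (w v - t * u v) *\<^sub>R v)"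
      using \<open>finite S\<close> \<open>s \<in> S\<close> \<open>w s - t * u s = 0\<close> by (simp add: sum.remove[of S s])
    finally have eq: "(\<Sum>v\<in>S. w v *\<^sub>R v) = (\<Sum>v\<in>S - {s}. (w v - t * u v) *\<^sub>R v)" .
    have "card (S - {s}) < card S"
      using \<open>finite S\<close> \<open>s \<in> S\<close> by (rule card_Diff1_less)
    then have "\<exists>T w'. T \<subseteq> S - {s} \<and> independent T \<and> (\<forall>v\<in>T. 0 \<le> w' v) \<and>
      (\<Sum>v\<in>S - {s}. (w v - t * u v) *\<^sub>R v) = (\<Sum>v\<in>T. w' v *\<^sub>R v)"
      by (rule less.hyps) (use nonneg \<open>finite S\<close> in auto)
    then show ?thesis
      unfolding eq by blast
  qed
qed

text \<open>A finitely generated cone is closed and convex, so a point outside it is strictly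
  separated from it. The normal of the hyperplane is nonnegative on the generators but negative on
  \<open>c\<close>.\<close>

lemma Farkas_convex_cone_hull:
  fixes S :: "'a::euclidean_space set"
  assumes "finite S" and nonneg: "\<And>d. (\<And>v. v \<in> S \<Longrightarrow> 0 \<le> v \<bullet> d) \<Longrightarrow> 0 \<le> c \<bullet> d"
  shows "c \<in> convex_cone hull S"
proof (rule ccontr)
  assume "c \<notin> convex_cone hull S"
  then obtain a \<beta> where a: "a \<bullet> c < \<beta>" "\<And>x. x \<in> convex_cone hull S \<Longrightarrow> a \<bullet> x > \<beta>"
    using separating_hyperplane_closed_point[of "convex_cone hull S" c]
      convex_convex_cone_hull closed_convex_cone_hull[OF \<open>finite S\<close>] by blast
  have "\<beta> < 0"
    using a(2)[OF convex_cone_hull_contains_0] by simp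
  have "0 \<le> v \<bullet> a" if "v \<in> S" for v
  proof (rule ccontr)
    assume neg: "\<not> 0 \<le> v \<bullet> a"
    \<comment> \<open>The factor is positive and puts the multiple of \<open>v\<close> exactly on
      the hyperplane, which the cone must not touch.\<close>
    then have "(\<beta> / (v \<bullet> a)) *\<^sub>R v \<in> convex_cone hull S"
      using that \<open>\<beta> < 0\<close> by (intro convex_cone_hull_mul hull_inc) (auto simp: divide_nonpos_nonpos)
    from a(2)[OF this] neg show False
      by (simp add: inner_commute)
  qed
  then have "0 \<le> c \<bullet> a"
    by (rule nonneg)
  with a(1) \<open>\<beta> < 0\<close> show False
    by (simp add: inner_commute)
qed

section \<open>Optimality conditions under linear constraints\<close>

lemma gradient_inner:
  assumes "h differentiable (at u)"
  shows "gradient h u \<bullet> d = frechet_derivative h (at u) d"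
proof -
  interpret linear "frechet_derivative h (at u)"
    using assms by (rule linear_frechet_derivative)
  have "frechet_derivative h (at u) d = frechet_derivative h (at u) (\<Sum>i\<in>UNIV. d $ i *\<^sub>R axis i 1)"
    by (simp add: basis_expansion flip: scalar_mult_eq_scaleR)
  also have "\<dots> = gradient h u \<bullet> d"
    by (simp add: sum scale gradient_def inner_vec_def mult.commute)
  finally show ?thesis ..
qed

text \<open>By Farkas it suffices that the derivative is nonnegative in every direction
  \<open>d\<close> that no active row decreases. Linearity of the constraints makes short steps
  along such a \<open>d\<close> feasible, so no constraint qualification enters.\<close>

lemma gradient_in_active_cone:
  fixes A :: "real^'p^'m"
  assumes u: "b \<le> A *v u" and diff: "h differentiable (at u)"
    and min: "\<And>w. b \<le> A *v w \<Longrightarrow> h u \<le> h w"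
  shows "gradient h u \<in> convex_cone hull ((\<lambda>j. row j A) ` {j. row j A \<bullet> u = b $ j})"
proof (rule Farkas_convex_cone_hull)
  fix d
  assume d: "\<And>v. v \<in> (\<lambda>j. row j A) ` {j. row j A \<bullet> u = b $ j} \<Longrightarrow> 0 \<le> v \<bullet> d"
  show "0 \<le> gradient h u \<bullet> d"
  proof (rule ccontr)
    assume "\<not> 0 \<le> gradient h u \<bullet> d"
    then have neg: "frechet_derivative h (at u) d < 0"
      by (simp add: gradient_inner[OF diff])
    \<comment> \<open>The base point is written as the value at \<open>t = 0\<close> of the line
      \<open>u + t d\<close>, the form the chain rule expects.\<close>
    have "(h has_derivative frechet_derivative h (at u)) (at (u + 0 *\<^sub>R d))"
      using diff by (simp add: frechet_derivative_works)
    then have "((\<lambda>t. h (u + t *\<^sub>R d)) has_derivative (\<lambda>t. frechet_derivative h (at u) (t *\<^sub>R d))) (at 0)"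
      by (rule has_derivative_compose[rotated]) (auto intro!: derivative_eq_intros)
    moreover have "(\<lambda>t. frechet_derivative h (at u) (t *\<^sub>R d)) = (*) (frechet_derivative h (at u) d)"
      by (simp add: linear_scale[OF linear_frechet_derivative[OF diff]] fun_eq_iff)
    ultimately have real: "((\<lambda>t. h (u + t *\<^sub>R d)) has_real_derivative frechet_derivative h (at u) d) (at 0)"
      by (simp add: has_field_derivative_def)
    obtain e where "0 < e" "\<forall>t>0. t < e \<longrightarrow> h (u + t *\<^sub>R d) < h u"
      using has_real_derivative_neg_dec_right[OF real neg] by auto
    then have dec: "\<forall>\<^sub>F t in at_right 0. h (u + t *\<^sub>R d) < h u"
      by (auto simp: eventually_at_right_field)
    \<comment> \<open>Active constraints persist by the choice of \<open>d\<close>, inactive ones by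
      continuity.\<close>
    have "\<forall>\<^sub>F t in at_right 0. b $ j \<le> row j A \<bullet> (u + t *\<^sub>R d)" for j
    proof (cases "row j A \<bullet> u = b $ j")
      case True
      then have "0 \<le> row j A \<bullet> d"
        using d by blast
      with True show ?thesis
        by (auto simp: inner_add_right eventually_at_right_field intro!: exI[of _ 1])
    next
      case False
      have "b $ j \<le> row j A \<bullet> u"
        using u by (simp add: less_eq_vec_def matrix_vector_mul_component row_def vec_nth_inverse)
      with False have "b $ j < row j A \<bullet> (u + 0 *\<^sub>R d)"
        by simp
      moreover have "((\<lambda>t. row j A \<bullet> (u + t *\<^sub>R d)) \<longlongrightarrow> row j A \<bullet> (u + 0 *\<^sub>R d)) (at_right 0)"
        by (intro tendsto_intros)
      ultimately have "\<forall>\<^sub>F t in at_right 0. b $ j < row j A \<bullet> (u + t *\<^sub>R d)"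
        by (rule order_tendstoD(1)[rotated])
      then show ?thesis
        by eventually_elim simp
    qed
    then have "\<forall>\<^sub>F t in at_right 0. \<forall>j. b $ j \<le> row j A \<bullet> (u + t *\<^sub>R d)"
      by (simp add: eventually_all_finite)
    with dec have "\<forall>\<^sub>F t in at_right (0::real). False"
    proof eventually_elim
      case (elim t)
      then have "b \<le> A *v (u + t *\<^sub>R d)"
        by (simp add: less_eq_vec_def matrix_vector_mul_component row_def vec_nth_inverse)
      with min elim show ?case
        by fastforce
    qed
    then show False
      by simp
  qed
qed simp

text \<open>Caratheodory leaves independent rows \<open>T\<close>; these extend to a basis
  \<open>B\<close> of the row space, with multiplier zero on the added rows. One index per basis
  vector then gives \<open>J\<close>.\<close>

lemma index_sets_multiplier:
  fixes A :: "real^'p^'m"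
  assumes "c \<in> convex_cone hull ((\<lambda>j. row j A) ` I)"
  obtains J l where "J \<in> index_sets A" "\<And>j. (0::real) \<le> l j" "\<And>j. j \<notin> I \<Longrightarrow> l j = 0"
    "c = (\<Sum>j\<in>J. l j *\<^sub>R row j A)"
proof -
  have "finite ((\<lambda>j. row j A) ` I)"
    by simp
  then obtain w0 where "\<And>v. v \<in> (\<lambda>j. row j A) ` I \<Longrightarrow> 0 \<le> w0 v"
    "c = (\<Sum>v\<in>(\<lambda>j. row j A) ` I. w0 v *\<^sub>R v)"
    using convex_cone_hull_image_sum[of "(\<lambda>j. row j A) ` I" c "\<lambda>v. v"] assms by auto
  then obtain T w where T: "T \<subseteq> (\<lambda>j. row j A) ` I" "independent T"
      and w: "\<forall>v\<in>T. 0 \<le> w v" and c: "c = (\<Sum>v\<in>T. w v *\<^sub>R v)"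
    using nonneg_combination_independent_subset[of "(\<lambda>j. row j A) ` I" w0] by auto
  have "T \<subseteq> rows A"
    using T by (auto simp: rows_def)
  then obtain B where B: "T \<subseteq> B" "B \<subseteq> rows A" "independent B" "rows A \<subseteq> span B"
    using maximal_independent_subset_extend T by blast
  \<comment> \<open>The same row may also occur at an index outside \<open>I\<close>. For vectors of
    \<open>T\<close> the index is forced into \<open>I\<close>, so that the multiplier vanishes off
    \<open>I\<close>.\<close>
  have "\<exists>j. row j A = v \<and> (v \<in> T \<longrightarrow> j \<in> I)" if "v \<in> B" for v
  proof (cases "v \<in> T")
    case True
    with T show ?thesis by blast
  next
    case False
    with B that show ?thesis by (auto simp: rows_def)
  qed
  then obtain r where "\<forall>v\<in>B. row (r v) A = v \<and> (v \<in> T \<longrightarrow> r v \<in> I)"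
    by metis
  then have r: "\<And>v. v \<in> B \<Longrightarrow> row (r v) A = v" "\<And>v. v \<in> T \<Longrightarrow> r v \<in> I"
    using B(1) by auto
  define l where "l = (\<lambda>j. if j \<in> r ` T then w (row j A) else 0)"
  have inj: "inj_on r B"
    using r by (metis inj_onI)
  have "(\<lambda>j. row j A) ` (r ` B) = B"
    using r by (force simp: image_iff)
  moreover have "card B = rank A"
    using B by (metis basis_card_eq_dim row_rank_def)
  moreover have "dim B = card B"
    using B by (simp add: dim_eq_card_independent)
  ultimately have "r ` B \<in> index_sets A"
    using inj by (simp add: index_sets_def card_image)
  moreover have "0 \<le> l j" for j
    using w r B by (auto simp: l_def subset_iff)
  moreover have "l j = 0" if "j \<notin> I" for j
    using that r by (auto simp: l_def)
  moreover have "c = (\<Sum>j\<in>r ` B. l j *\<^sub>R row j A)"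
  proof -
    have fin: "finite B"
      using B independent_bound by blast
    have "(\<Sum>j\<in>r ` B. l j *\<^sub>R row j A) = (\<Sum>v\<in>B. l (r v) *\<^sub>R v)"
      using inj r by (simp add: sum.reindex)
    also have "\<dots> = (\<Sum>v\<in>T. l (r v) *\<^sub>R v)"
      using B(1) fin inj by (intro sum.mono_neutral_right) (auto simp: l_def inj_on_def)
    also have "\<dots> = c"
      unfolding c using B r by (intro sum.cong) (auto simp: l_def subset_iff)
    finally show ?thesis ..
  qed
  ultimately show thesis
    using that by blast
qed

text \<open>Farkas' lemma for the generators \<open>(a\<^sub>j, b\<^sub>j(x))\<close> and the vector \<open>(0, 1)\<close>.\<close>

lemma U_set_empty_iff:
  fixes A :: "real^'p^'m"
  shows "U_set A b x = {} \<longleftrightarrow> (\<exists>y\<ge>0. transpose A *v y = 0 \<and> b x \<bullet> y = 1)"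
proof
  assume empty: "U_set A b x = {}"
  have "(0, 1) \<in> convex_cone hull range (\<lambda>j. (row j A, b x $ j))"
  proof (rule Farkas_convex_cone_hull)
    fix d :: "(real^'p) \<times> real"
    assume d: "\<And>v. v \<in> range (\<lambda>j. (row j A, b x $ j)) \<Longrightarrow> 0 \<le> v \<bullet> d"
    show "0 \<le> (0, 1) \<bullet> d"
    proof (rule ccontr)
      assume "\<not> 0 \<le> (0, 1) \<bullet> d"
      then have neg: "snd d < 0"
        by (simp add: inner_prod_def)
      \<comment> \<open>Dividing by the positive number \<open>- snd d\<close> normalises the last
        coordinate of \<open>d\<close> to -1 and turns its first part into a point of
        \<open>U(x)\<close>.\<close>
      have "b x $ j \<le> row j A \<bullet> (- inverse (snd d) *\<^sub>R fst d)" for j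
      proof -
        have "0 \<le> row j A \<bullet> fst d + b x $ j * snd d"
          using d[of "(row j A, b x $ j)"] by (simp add: inner_prod_def)
        with neg show ?thesis
          by (simp add: field_simps)
      qed
      then have "- inverse (snd d) *\<^sub>R fst d \<in> U_set A b x"
        by (simp add: U_set_def less_eq_vec_def matrix_vector_mul_component row_def vec_nth_inverse)
      with empty show False
        by blast
    qed
  qed simp
  then obtain w where w: "\<And>j. 0 \<le> w j" "(0, 1) = (\<Sum>j\<in>UNIV. w j *\<^sub>R (row j A, b x $ j))"
    by (rule convex_cone_hull_image_sum[rotated]) auto
  have "transpose A *v (\<chi> j. w j) = fst (\<Sum>j\<in>UNIV. w j *\<^sub>R (row j A, b x $ j))"
    by (simp add: matrix_vector_column fst_sum scalar_mult_eq_scaleR column_transpose column_def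
        row_def transpose_def)
  moreover have "b x \<bullet> (\<chi> j. w j) = snd (\<Sum>j\<in>UNIV. w j *\<^sub>R (row j A, b x $ j))"
    by (simp add: inner_vec_def snd_sum mult.commute)
  ultimately show "\<exists>y\<ge>0. transpose A *v y = 0 \<and> b x \<bullet> y = 1"
    using w(1) unfolding w(2)[symmetric] by (intro exI[of _ "\<chi> j. w j"]) (simp add: less_eq_vec_def)
next
  assume "\<exists>y\<ge>0. transpose A *v y = 0 \<and> b x \<bullet> y = 1"
  then obtain y where y: "y \<ge> 0" "transpose A *v y = 0" "b x \<bullet> y = 1"
    by blast
  have False if "b x \<le> A *v u" for u
  proof -
    \<comment> \<open>Weak duality: the chain gives 1 \<le> 0.\<close>
    have "b x \<bullet> y \<le> (A *v u) \<bullet> y"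
      using that y(1) by (auto simp: inner_vec_def less_eq_vec_def intro!: sum_mono mult_right_mono)
    also have "\<dots> = u \<bullet> (transpose A *v y)"
      by (metis dot_lmul_matrix inner_commute transpose_matrix_vector)
    finally show False
      using y by simp
  qed
  then show "U_set A b x = {}"
    by (auto simp: U_set_def)
qed

section \<open>Optimal values, compactness of \<open>U(x)\<close>, and points of
  \<open>K_set\<close>\<close>

lemma opt_value_arg_min:
  "is_arg_min h (\<lambda>z. z \<in> F) a \<Longrightarrow> opt_value h F = ereal (h a)"
  unfolding opt_value_def
  by (intro antisym INF_lower INF_greatest) (auto simp: is_arg_min_linorder)

lemma opt_value_le: "z \<in> F \<Longrightarrow> opt_value h F \<le> ereal (h z)"
  unfolding opt_value_def by (rule INF_lower)

lemma value_fun_nonneg_iff: "0 \<le> value_fun g A b x \<longleftrightarrow> (\<forall>u\<in>U_set A b x. 0 \<le> g x u)"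
  by (auto simp: value_fun_def opt_value_def le_INF_iff)

lemma gsip_feasible_iff: "x \<in> gsip_feasible X g A b \<longleftrightarrow> x \<in> X \<and> 0 \<le> value_fun g A b x"
  by (simp add: gsip_feasible_def value_fun_nonneg_iff)

lemma closed_U_set: "closed (U_set A b x)"
proof -
  have "U_set A b x = (\<Inter>j. {u. b x $ j \<le> row j A \<bullet> u})"
    by (auto simp: U_set_def less_eq_vec_def matrix_vector_mul_component row_def vec_nth_inverse)
  then show ?thesis
    by (simp add: closed_INT closed_halfspace_ge)
qed

lemma compact_U_set:
  assumes "locally_bounded_on X (U_set A b)" "x \<in> X"
  shows "compact (U_set A b x)"
proof -
  obtain C1 C2 where "x \<in> interior C1" "bounded C2" "\<forall>z\<in>C1. U_set A b z \<subseteq> C2"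
    using assms unfolding locally_bounded_on_def by meson
  then have "bounded (U_set A b x)"
    using interior_subset bounded_subset by blast
  then show ?thesis
    by (simp add: compact_eq_bounded_closed closed_U_set)
qed

text \<open>The multiplier vanishes on inactive rows, so every term of the complementarity sum is
  zero.\<close>

lemma minimizer_in_K_set:
  assumes "u \<in> U_set A b x" "g x differentiable (at u)"
    and "\<And>w. w \<in> U_set A b x \<Longrightarrow> g x u \<le> g x w"
  obtains J where "J \<in> index_sets A" "u \<in> K_set g A b J x"
proof -
  have "gradient (g x) u \<in> convex_cone hull ((\<lambda>j. row j A) ` {j. row j A \<bullet> u = b x $ j})"
    using assms by (intro gradient_in_active_cone) (auto simp: U_set_def)
  then obtain J l where J: "J \<in> index_sets A"
    and l: "\<And>j. (0::real) \<le> l j" "\<And>j. row j A \<bullet> u \<noteq> b x $ j \<Longrightarrow> l j = 0"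
      "gradient (g x) u = (\<Sum>j\<in>J. l j *\<^sub>R row j A)"
    by (rule index_sets_multiplier) auto
  have "\<forall>j. 0 \<le> row j A \<bullet> u - b x $ j"
    using assms(1) by (simp add: U_set_def less_eq_vec_def matrix_vector_mul_component row_def vec_nth_inverse)
  moreover have "(row j A \<bullet> u - b x $ j) * l j = 0" for j
    using l(2)[of j] by (cases "row j A \<bullet> u = b x $ j") auto
  then have "(\<Sum>j\<in>J. (row j A \<bullet> u - b x $ j) * l j) = 0"
    by (intro sum.neutral) blast
  ultimately have "u \<in> K_set g A b J x"
    using assms(1) l unfolding K_set_def by (auto intro!: exI[of _ l])
  with J that show thesis
    by blast
qed

lemma K_set_nonempty:
  assumes "compact (U_set A b x)" "U_set A b x \<noteq> {}" "real_polynomial_function (g x)"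
  obtains J u where "J \<in> index_sets A" "u \<in> K_set g A b J x"
proof -
  have "continuous_on (U_set A b x) (g x)"
    using assms(3) by (intro differentiable_imp_continuous_on differentiable_on_real_polynomial_function)
  then obtain u where "u \<in> U_set A b x" "\<And>w. w \<in> U_set A b x \<Longrightarrow> g x u \<le> g x w"
    using continuous_attains_inf[OF assms(1,2)] by blast
  moreover have "g x differentiable (at u)"
    using assms(3) by (rule differentiable_at_real_polynomial_function)
  ultimately show thesis
    using minimizer_in_K_set[of u A b x g] that by blast
qed

text \<open>Fixing \<open>x\<close> is composition with the affine embedding of \<open>u\<close> as
  \<open>(x, u)\<close>, split into a constant and a bounded linear map.\<close>

lemma real_polynomial_function_slice:
  assumes "real_polynomial_function (\<lambda>z. g (fst z) (snd z))"
  shows "real_polynomial_function (g x)"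
proof -
  have "polynomial_function (\<lambda>u. (x, 0) + (0, u))"
    by (intro polynomial_function_add polynomial_function_const polynomial_function_bounded_linear
        bounded_linear_Pair bounded_linear_zero bounded_linear_ident)
  from real_polynomial_function_compose[OF this assms] show ?thesis
    by (simp add: o_def)
qed

section \<open>Candidates produced by the algorithm\<close>

lemma step1_feasible_iff: "(\<exists>y. (x, y) \<in> step1_feasible X A b) \<longleftrightarrow> x \<in> X \<and> U_set A b x = {}"
  by (auto simp: step1_feasible_def U_set_empty_iff)

lemma step1_lower:
  assumes "step1 X f A b fbar xbar ybar \<Phi>0" "x \<in> X" "U_set A b x = {}"
  shows "fbar \<le> ereal (f x)"
proof -
  obtain y where "(x, y) \<in> step1_feasible X A b"
    using assms step1_feasible_iff by blast
  from opt_value_le[OF this, of "\<lambda>(x, y). f x"] show ?thesis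
    using assms(1) by (simp add: step1_def)
qed

lemma step1_attained:
  assumes "step1 X f A b fbar xbar ybar \<Phi>0" "fbar < \<infinity>"
  shows "xbar \<in> gsip_feasible X g A b" "fbar = ereal (f xbar)"
proof -
  have "step1_feasible X A b \<noteq> {}"
  proof
    assume "step1_feasible X A b = {}"
    then have "fbar = \<infinity>"
      using assms(1) by (simp add: step1_def opt_value_def top_ereal_def)
    with assms(2) show False
      by simp
  qed
  then have *: "is_arg_min (\<lambda>(x, y). f x) (\<lambda>z. z \<in> step1_feasible X A b) (xbar, ybar)"
    "fbar = opt_value (\<lambda>(x, y). f x) (step1_feasible X A b)"
    using assms(1) by (auto simp: step1_def)
  then show "fbar = ereal (f xbar)"
    using opt_value_arg_min by fastforce
  have "(xbar, ybar) \<in> step1_feasible X A b"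
    using *(1) by (simp add: is_arg_min_def)
  \<comment> \<open>Here \<open>U(xbar)\<close> is empty, so the semi-infinite constraint holds
    vacuously.\<close>
  then show "xbar \<in> gsip_feasible X g A b"
    using step1_feasible_iff[of xbar X A b] by (auto simp: gsip_feasible_def)
qed

lemma step1_maps:
  assumes "step1 X f A b fbar xbar ybar \<Phi>0" "x \<in> X"
  shows "\<forall>\<phi>\<in>\<Phi>0. \<phi> x \<in> U_set A b x"
  using assms by (auto simp: step1_def split: if_splits)

text \<open>Induction over the iterations. A map \<open>q k\<close> is a selection only where
  \<open>U(x)\<close> is nonempty, and the sequences are constrained only as long as no earlier
  iteration has stopped.\<close>

lemma inner_loop_maps:
  assumes "inner_loop X f g A b \<Phi>0 J \<Phi> xs us uh q"
    and \<Phi>0: "\<forall>\<phi>\<in>\<Phi>0. \<phi> x \<in> U_set A b x"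
    and "x \<in> X" "U_set A b x \<noteq> {}"
    and "\<forall>i<k. \<not> stops_at X g A b J \<Phi> xs i" "\<phi> \<in> \<Phi> k"
  shows "\<phi> x \<in> U_set A b x"
  using assms(5,6)
proof (induction k)
  case 0
  then show ?case
    using assms(1) \<Phi>0 by (simp add: inner_loop_def)
next
  case (Suc k)
  then have "\<forall>x\<in>X. U_set A b x \<noteq> {} \<longrightarrow> q k x \<in> U_set A b x" "\<Phi> (Suc k) = \<Phi> k \<union> {q k}"
    using assms(1) by (auto simp: inner_loop_def)
  then show ?case
    using Suc assms(3,4) by auto
qed

text \<open>A finite result means that the loop stopped by the test on the value function, and a
  nonnegative value is exactly the semi-infinite constraint.\<close>

lemma inner_loop_attained:
  assumes loop: "inner_loop X f g A b \<Phi>0 J \<Phi> xs us uh q"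
    and "inner_loop_terminates X g A b J \<Phi> xs"
    and res: "inner_loop_result X f g A b J \<Phi> xs us fJ xJ uJ"
    and "fJ < \<infinity>"
  shows "xJ \<in> gsip_feasible X g A b" "fJ = ereal (f xJ)"
proof -
  \<comment> \<open>The first stopping index is taken, since only there does
    \<open>inner_loop_result\<close> fix the output.\<close>
  obtain k where k: "stops_at X g A b J \<Phi> xs k" "\<forall>i<k. \<not> stops_at X g A b J \<Phi> xs i"
    using assms(2) unfolding inner_loop_terminates_def by (meson exists_least_iff)
  let ?F = "sub_feasible X g A b J (\<Phi> k)"
  have "?F \<noteq> {}" "fJ = opt_value (\<lambda>(x, u). f x) ?F" "xJ = xs k"
    using res k \<open>fJ < \<infinity>\<close> by (auto simp: inner_loop_result_def split: if_splits)
  moreover from this have min: "is_arg_min (\<lambda>(x, u). f x) (\<lambda>z. z \<in> ?F) (xs k, us k)"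
    using loop k by (simp add: inner_loop_def)
  ultimately show "fJ = ereal (f xJ)"
    by (simp add: opt_value_arg_min)
  have "xs k \<in> X"
    using min by (simp add: is_arg_min_def sub_feasible_def)
  then show "xJ \<in> gsip_feasible X g A b"
    using k \<open>?F \<noteq> {}\<close> \<open>xJ = xs k\<close> by (simp add: stops_at_def gsip_feasible_iff)
qed

text \<open>The accumulated cuts never remove \<open>(x, u)\<close>: each map sends \<open>x\<close>
  into \<open>U(x)\<close>, where \<open>g x\<close> is nonnegative by feasibility. The final
  subproblem is therefore a relaxation containing this point.\<close>

lemma inner_loop_lower:
  assumes "inner_loop X f g A b \<Phi>0 J \<Phi> xs us uh q"
    and "inner_loop_terminates X g A b J \<Phi> xs"
    and res: "inner_loop_result X f g A b J \<Phi> xs us fJ xJ uJ"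
    and "\<forall>\<phi>\<in>\<Phi>0. \<phi> x \<in> U_set A b x"
    and x: "x \<in> gsip_feasible X g A b" and u: "u \<in> K_set g A b J x"
  shows "fJ \<le> ereal (f x)"
proof -
  obtain k where k: "stops_at X g A b J \<Phi> xs k" "\<forall>i<k. \<not> stops_at X g A b J \<Phi> xs i"
    using assms(2) unfolding inner_loop_terminates_def by (meson exists_least_iff)
  have "u \<in> U_set A b x" "x \<in> X"
    using x u by (auto simp: K_set_def gsip_feasible_def)
  then have "\<phi> x \<in> U_set A b x" if "\<phi> \<in> \<Phi> k" for \<phi>
    using inner_loop_maps[OF assms(1) assms(4) _ _ k(2) that] by blast
  then have xu: "(x, u) \<in> sub_feasible X g A b J (\<Phi> k)"
    using x u \<open>u \<in> U_set A b x\<close> by (auto simp: sub_feasible_def gsip_feasible_def)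
  then have "fJ = opt_value (\<lambda>(x, u). f x) (sub_feasible X g A b J (\<Phi> k))"
    using res k by (auto simp: inner_loop_result_def split: if_splits)
  then show ?thesis
    using opt_value_le[OF xu, of "\<lambda>(x, u). f x"] by simp
qed

theorem theorem4p6:
  fixes X :: "(real^'n) set"
    and f :: "real^'n \<Rightarrow> real"
    and g :: "real^'n \<Rightarrow> real^'p \<Rightarrow> real"
    and A :: "real^'p^'m"
    and b :: "real^'n \<Rightarrow> real^'m"
    and fbar fstar :: ereal
    and xbar xstar :: "real^'n"
    and ybar :: "real^'m"
    and \<Phi>0 :: "(real^'n \<Rightarrow> real^'p) set"
    and \<Phi> :: "'m set \<Rightarrow> nat \<Rightarrow> (real^'n \<Rightarrow> real^'p) set"
    and xs :: "'m set \<Rightarrow> nat \<Rightarrow> real^'n"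
    and us uh :: "'m set \<Rightarrow> nat \<Rightarrow> real^'p"
    and q :: "'m set \<Rightarrow> nat \<Rightarrow> real^'n \<Rightarrow> real^'p"
    and fJ :: "'m set \<Rightarrow> ereal"
    and xJ :: "'m set \<Rightarrow> real^'n"
    and uJ :: "'m set \<Rightarrow> real^'p"
  assumes "semialgebraic X"
    and "real_polynomial_function f"
    and "real_polynomial_function (\<lambda>z. g (fst z) (snd z))"
    and "\<And>i. real_polynomial_function (\<lambda>x. b x $ i)"
    and "locally_bounded_on X (U_set A b)"
    and "step1 X f A b fbar xbar ybar \<Phi>0"
    and "\<And>J. J \<in> index_sets A \<Longrightarrow>
           inner_loop X f g A b \<Phi>0 J (\<Phi> J) (xs J) (us J) (uh J) (q J)"
    and "\<And>J. J \<in> index_sets A \<Longrightarrow> inner_loop_terminates X g A b J (\<Phi> J) (xs J)"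
    and "\<And>J. J \<in> index_sets A \<Longrightarrow>
           inner_loop_result X f g A b J (\<Phi> J) (xs J) (us J) (fJ J) (xJ J) (uJ J)"
    and "step3 A fbar xbar fJ xJ fstar xstar"
  shows "fstar = opt_value f (gsip_feasible X g A b) \<and>
         (fstar < \<infinity> \<longrightarrow> is_arg_min f (\<lambda>x. x \<in> gsip_feasible X g A b) xstar)"

proof -
  let ?F = "gsip_feasible X g A b"
  have fstar: "fstar = Min ({fbar} \<union> fJ ` index_sets A)"
    using assms(10) by (simp add: step3_def)
  have lower: "fstar \<le> ereal (f x)" if x: "x \<in> ?F" for x
  proof (cases "U_set A b x = {}")
    case True
    then have "fbar \<le> ereal (f x)"
      using step1_lower[OF assms(6)] x by (simp add: gsip_feasible_def)
    moreover have "fstar \<le> fbar"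
      unfolding fstar by (intro Min_le) auto
    ultimately show ?thesis
      by order
  next
    case False
    have "x \<in> X"
      using x by (simp add: gsip_feasible_def)
    with False obtain J u where J: "J \<in> index_sets A" and u: "u \<in> K_set g A b J x"
      using K_set_nonempty compact_U_set[OF assms(5)] real_polynomial_function_slice[OF assms(3)]
      by metis
    have "fJ J \<le> ereal (f x)"
      using inner_loop_lower[OF assms(7-9)[OF J] step1_maps[OF assms(6) \<open>x \<in> X\<close>] x u] .
    moreover have "fstar \<le> fJ J"
      unfolding fstar using J by (intro Min_le) auto
    ultimately show ?thesis
      by order
  qed
  \<comment> \<open>A tie between \<open>fbar\<close> and some \<open>fJ J\<close> is resolved in
    favour of Step 1, as in \<open>step3\<close>.\<close>
  have attained: "xstar \<in> ?F \<and> fstar = ereal (f xstar)" if "fstar < \<infinity>"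
  proof (cases "fstar = fbar")
    case True
    with that show ?thesis
      using step1_attained[OF assms(6)] assms(10) by (simp add: step3_def)
  next
    case False
    then obtain J where "J \<in> index_sets A" "fstar = fJ J" "xstar = xJ J"
      using assms(10) by (auto simp: step3_def)
    with that show ?thesis
      using inner_loop_attained[OF assms(7-9)] by metis
  qed
  have arg_min: "is_arg_min f (\<lambda>x. x \<in> ?F) xstar" if "fstar < \<infinity>"
    using lower attained[OF that] by (auto simp: is_arg_min_linorder)
  moreover have "fstar = opt_value f ?F"
  proof (cases "fstar < \<infinity>")
    case True
    then show ?thesis
      using attained opt_value_arg_min[OF arg_min] by simp
  next
    case False
    \<comment> \<open>An infinite lower bound leaves no feasible point, and the infimum over the
      empty set is infinite as well.\<close>
    then have "?F = {}"
      using lower by fastforce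
    with False show ?thesis
      by (simp add: opt_value_def top_ereal_def)
  qed
  ultimately show ?thesis
    by blast
qed

end
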